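(* Let $B=\{s\in\mathbb{C}:\Re(s)\in(0,1)\}$. For every $w\in B$, \[ \zeta(w)=0 \iff \sup_{t\ge 1}\left|\psi_w\!\left(\tfrac{1}{1-w},t\right)\right|<+\infty , \] and for every $w\in B$, \[ \zeta(w)=0 \iff \sup_{t\ge 1}\left|\,t\left(\psi_w\!\left(\tfrac{1}{1-w},t\right)+\frac{1}{2w}\right)\right|<+\infty . \]
   Context: $\{u\}$ denotes the fractional part of the real number $u$. The Riemann zeta function is given for $s\in\mathbb{C}$, $s\neq 1$, $\Re(s)>0$, by \[ \zeta(s)=-\frac{s}{1-s}-s\int_1^{+\infty}u^{-1-s}\{u\}\,du . \] For $w\in B$ and $z\in\mathbb{C}$, $\psi_w(z,\cdot):[1,+\infty)\to\mathbb{C}$ denotes the unique continuous function $x:[1,+\infty)\to\mathbb{C}$ with $x(1)=z$ satisfying the differential equation \[ \frac{d}{dt}x=w\,t^{-1}x+t^{-1}\{t\},\qquad t\in[1,+\infty)\setminus\mathbb{N}; \] explicitly, $\psi_w(z,t)=t^{w}\left[z+\int_1^t u^{-1-w}\{u\}\,du\right]$ for all $t\ge 1$. *)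

theory Defs
  imports "HOL-Analysis.Analysis"
begin

definition critical_strip :: "complex set" where
  "critical_strip = {s. Re s \<in> {0<..<1}}"

(* Represents the Riemann zeta function only where Re s > 0 and s \<noteq> 1; there the
   integrand is absolutely integrable (lemma zeta_integrand_absolutely_integrable). *)
definition riemann_zeta :: "complex \<Rightarrow> complex" where
  "riemann_zeta s =
     - (s / (1 - s)) - s * integral {1..} (\<lambda>u::real. of_real u powr (- 1 - s) * of_real (frac u))"

(* x solves the initial value problem on [1,\<infinity>). *)
definition psi_ivp :: "complex \<Rightarrow> complex \<Rightarrow> (real \<Rightarrow> complex) \<Rightarrow> bool" where
  "psi_ivp w z x \<longleftrightarrow>
     continuous_on {1..} x \<and> x 1 = z \<and>
     (\<forall>t\<in>{1..} - \<nat>.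
        (x has_vector_derivative (w * of_real (inverse t) * x t + of_real (inverse t * frac t))) (at t))"

(* HOL functions are total, so the solution is made unique by prescribing
   the value undefined outside [1,\<infinity>). *)
definition psi :: "complex \<Rightarrow> complex \<Rightarrow> real \<Rightarrow> complex" where
  "psi w z = (THE x. x \<in> extensional {1..} \<and> psi_ivp w z x)"

lemma norm_powr_frac_le:
  assumes "u \<ge> 1"
  shows "norm (of_real u powr (- 1 - s) * complex_of_real (frac u)) \<le> u powr (- 1 - Re s)"
proof -
  have "norm (of_real u powr (- 1 - s)) = u powr (- 1 - Re s)"
    using assms by (subst norm_powr_real_powr) auto
  moreover have "norm (complex_of_real (frac u)) \<le> 1"
    using frac_lt_1[of u] frac_ge_0[of u] by (simp add: less_imp_le)
  ultimately show ?thesis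
    by (simp add: norm_mult mult_left_le)
qed

lemma powr_frac_measurable:
  assumes "S \<in> sets lebesgue" "S \<subseteq> {1..}"
  shows "(\<lambda>u::real. of_real u powr (- 1 - s) * complex_of_real (frac u)) \<in> borel_measurable (lebesgue_on S)"
proof (rule borel_measurable_times)
  have "continuous_on S (\<lambda>u::real. complex_of_real u powr (- 1 - s))"
    using assms by (intro continuous_intros) auto
  then show "(\<lambda>u::real. complex_of_real u powr (- 1 - s)) \<in> borel_measurable (lebesgue_on S)"
    using assms by (intro continuous_imp_measurable_on_sets_lebesgue)
  have "(\<lambda>u::real. complex_of_real (frac u)) \<in> borel_measurable borel"
    unfolding frac_def by measurable
  then have "(\<lambda>u::real. complex_of_real (frac u)) \<in> borel_measurable lebesgue"
    by (intro measurable_completion) simp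
  then show "(\<lambda>u::real. complex_of_real (frac u)) \<in> borel_measurable (lebesgue_on S)"
    by (rule measurable_restrict_space1)
qed

lemma zeta_integrand_absolutely_integrable:
  assumes "Re s > 0"
  shows "(\<lambda>u::real. of_real u powr (- 1 - s) * complex_of_real (frac u)) absolutely_integrable_on {1..}"
proof (rule measurable_bounded_by_integrable_imp_absolutely_integrable)
  show "(\<lambda>u. u powr (- 1 - Re s)) integrable_on {1..}"
    using has_integral_powr_to_inf[of "- 1 - Re s" 1] assms by auto
qed (simp_all add: powr_frac_measurable norm_powr_frac_le)

lemma powr_frac_integrable:
  "(\<lambda>u::real. of_real u powr (- 1 - s) * complex_of_real (frac u)) integrable_on {1..b}"
proof -
  have "(\<lambda>u::real. of_real u powr (- 1 - s) * complex_of_real (frac u)) absolutely_integrable_on {1..b}"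
  proof (rule measurable_bounded_by_integrable_imp_absolutely_integrable)
    show "(\<lambda>u::real. u powr (- 1 - Re s)) integrable_on {1..b}"
      by (intro integrable_continuous_interval continuous_intros) auto
  qed (simp_all add: powr_frac_measurable norm_powr_frac_le)
  then show ?thesis
    using absolutely_integrable_on_def by blast
qed

lemma powr_has_vector_derivative:
  assumes "t > 0"
  shows "((\<lambda>t. complex_of_real t powr w) has_vector_derivative (w * of_real t powr (w - 1))) (at t)"
  using assms by (intro has_vector_derivative_real_field has_field_derivative_powr) auto

lemma isCont_frac:
  assumes "t > 1" "t \<notin> \<nat>"
  shows "isCont frac (t::real)"
proof -
  have "t \<notin> \<int>"
    using assms by (auto simp: Nats_altdef1 elim!: Ints_cases)
  then show ?thesis
    by (rule continuous_frac)
qed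

lemma psi_ivp_explicit:
  "psi_ivp w z (\<lambda>t. of_real t powr w *
     (z + integral {1..t} (\<lambda>u::real. of_real u powr (- 1 - w) * of_real (frac u))))"
proof -
  define f where "f = (\<lambda>u::real. of_real u powr (- 1 - w) * complex_of_real (frac u))"
  have int: "f integrable_on {1..b}" for b
    unfolding f_def by (rule powr_frac_integrable)
  have cont: "continuous_on {1..} (\<lambda>t. integral {1..t} f)"
  proof (subst continuous_on_eq_continuous_within, intro ballI)
    fix t :: real assume "t \<in> {1..}"
    then have "continuous (at t within {1..t+1}) (\<lambda>t. integral {1..t} f)"
      using indefinite_integral_continuous_1[OF int[of "t+1"]]
      by (auto simp: continuous_on_eq_continuous_within)
    moreover have "at t within {1..t+1} = at t within {1..}"
      by (rule at_within_nhd[where S="{..<t+1}"]) auto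
    ultimately show "continuous (at t within {1..}) (\<lambda>t. integral {1..t} f)" by simp
  qed
  have "((\<lambda>t. of_real t powr w * (z + integral {1..t} f)) has_vector_derivative
      (w * of_real (inverse t) * (of_real t powr w * (z + integral {1..t} f))
        + of_real (inverse t * frac t))) (at t)" if t: "t \<in> {1..} - \<nat>" for t
  proof -
    from t have t1: "t > 1"
      by (cases "t = 1") auto
    have "isCont (\<lambda>u::real. complex_of_real u powr (- 1 - w)) t"
      using powr_has_vector_derivative[of t "- 1 - w"] t1
      by (intro has_vector_derivative_continuous) auto
    moreover have "isCont frac t"
      using t1 t by (intro isCont_frac) auto
    ultimately have "isCont f t"
      unfolding f_def by (intro continuous_mult continuous_of_real)
    then have "((\<lambda>t. integral {1..t} f) has_vector_derivative f t) (at t within {1..t+1} - {})"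
      using t1 by (intro integral_has_vector_derivative_continuous_at int)
        (auto intro: continuous_at_imp_continuous_within)
    moreover have "at t within {1..t+1} - {} = at t"
      using t1 by (simp add: at_within_Icc_at)
    ultimately have "((\<lambda>t. integral {1..t} f) has_vector_derivative f t) (at t)" by simp
    then have "((\<lambda>t. of_real t powr w * (z + integral {1..t} f)) has_vector_derivative
        (of_real t powr w * (0 + f t) + w * of_real t powr (w - 1) * (z + integral {1..t} f))) (at t)"
      using t1 by (intro has_vector_derivative_mult powr_has_vector_derivative
          has_vector_derivative_add has_vector_derivative_const) auto
    moreover have "of_real t powr w * f t = of_real (inverse t * frac t)"
      using t1 unfolding f_def
      by (simp add: powr_diff powr_minus field_simps)
    moreover have "complex_of_real t powr (w - 1) = of_real (inverse t) * of_real t powr w"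
      using t1 by (simp add: powr_diff field_simps)
    ultimately show ?thesis
      by (simp add: mult_ac add_ac)
  qed
  moreover have "continuous_on {1..} (\<lambda>t::real. of_real t powr w * (z + integral {1..t} f))"
    using cont by (intro continuous_intros) auto
  ultimately show ?thesis
    unfolding psi_ivp_def f_def by simp
qed

lemma psi_ivp_unique:
  assumes x: "psi_ivp w z x" and y: "psi_ivp w z y" and t: "t \<ge> 1"
  shows "x t = y t"
proof -
  define d where "d = (\<lambda>t. of_real t powr (- w) * (x t - y t))"
  have "d t = 0"
  proof (rule has_derivative_zero_unique_strong_interval[where a=1 and b=t and k="{1..t} \<inter> \<nat> \<union> {t}"])
    have "{1..t} \<inter> \<nat> \<subseteq> of_nat ` {..nat \<lfloor>t\<rfloor>}"
      by (auto elim!: Nats_cases intro!: imageI simp: le_nat_floor)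
    then show "finite ({1..t} \<inter> \<nat> \<union> {t})"
      using finite_subset by blast
    show "continuous_on {1..t} d"
      unfolding d_def using x y unfolding psi_ivp_def
      by (intro continuous_intros) (auto elim: continuous_on_subset)
    show "d 1 = 0"
      using x y by (simp add: d_def psi_ivp_def)
    show "t \<in> {1..t}" using t by simp
    fix u assume u: "u \<in> {1..t} - ({1..t} \<inter> \<nat> \<union> {t})"
    then have u': "u \<in> {1..} - \<nat>" and u0: "u > 0" by auto
    have "(d has_vector_derivative
        (of_real u powr (- w) *
          ((w * of_real (inverse u) * x u + of_real (inverse u * frac u)) -
           (w * of_real (inverse u) * y u + of_real (inverse u * frac u)))
         + (- w) * of_real u powr (- w - 1) * (x u - y u))) (at u)"
      unfolding d_def using x y u' u0 unfolding psi_ivp_def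
      by (intro has_vector_derivative_mult powr_has_vector_derivative has_vector_derivative_diff) auto
    moreover have "of_real u powr (- w - 1) = of_real u powr (- w) * complex_of_real (inverse u)"
      using u0 by (simp add: powr_diff field_simps)
    ultimately have "(d has_vector_derivative 0) (at u)"
      by (simp add: algebra_simps)
    then show "(d has_derivative (\<lambda>h. 0)) (at u within {1..t})"
      by (simp add: has_vector_derivative_def has_derivative_at_withinI)
  qed
  then show ?thesis
    using t by (auto simp: d_def)
qed

lemma psi_ivp_cong:
  assumes "\<And>t. t \<ge> 1 \<Longrightarrow> x t = y t" "psi_ivp w z x"
  shows "psi_ivp w z y"
proof -
  have "(y has_vector_derivative (w * of_real (inverse t) * y t + of_real (inverse t * frac t))) (at t)"
    if t: "t \<in> {1..} - \<nat>" for t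
  proof -
    from t have "t > 1"
      by (cases "t = 1") auto
    moreover have "(x has_vector_derivative (w * of_real (inverse t) * y t + of_real (inverse t * frac t))) (at t)"
      using assms t unfolding psi_ivp_def by auto
    ultimately show ?thesis
      using assms(1) by (elim has_vector_derivative_transform_within_open[where S="{1<..}"]) auto
  qed
  moreover have "continuous_on {1..} y"
    using assms continuous_on_cong[of "{1..}" "{1..}" x y] by (simp add: psi_ivp_def)
  ultimately show ?thesis
    using assms unfolding psi_ivp_def by auto
qed

lemma psi_ivp_ex1: "\<exists>!x. x \<in> extensional {1..} \<and> psi_ivp w z x"
proof -
  obtain x where "psi_ivp w z x" using psi_ivp_explicit by blast
  then have "psi_ivp w z (restrict x {1..})"
    by (rule psi_ivp_cong[rotated]) auto
  then show ?thesis
    by (intro ex1I[of _ "restrict x {1..}"]) (auto intro: extensionalityI psi_ivp_unique)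
qed

lemma psi_ivp_psi: "psi_ivp w z (psi w z)"
  unfolding psi_def using theI'[OF psi_ivp_ex1] by blast

lemma psi_explicit:
  assumes "t \<ge> 1"
  shows "psi w z t = of_real t powr w *
    (z + integral {1..t} (\<lambda>u::real. of_real u powr (- 1 - w) * of_real (frac u)))"
  using psi_ivp_unique[OF psi_ivp_psi psi_ivp_explicit assms] .

end

theory Submission
  imports Defs
begin

text \<open>Splitting the integral in the definition of \<open>riemann_zeta\<close> at \<open>t\<close> gives
  \<open>psi w (1 / (1 - w)) t = - (riemann_zeta w / w) * t\<^sup>w - t\<^sup>w * R t\<close> with
  \<open>R t\<close> the integral over \<open>{t..}\<close>. The last term is bounded, while \<open>\<bar>t\<^sup>w\<bar>\<close> tends to
  infinity, so \<open>psi\<close> is bounded precisely when \<open>riemann_zeta w = 0\<close>. For the second equivalence,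
  replacing \<open>frac u\<close> by its mean \<open>1/2\<close> contributes \<open>1 / (2 * w)\<close> to \<open>t\<^sup>w * R t\<close>; integrating the
  remainder \<open>frac u - 1/2\<close> by parts against its bounded continuous primitive
  \<open>- frac u * (1 - frac u) / 2\<close> gains a factor \<open>1 / t\<close>.\<close>

section \<open>The periodic primitive used for the integration by parts\<close>

text \<open>In terms of the second Bernoulli polynomial B_2 this is 1/6 -
  B_2(\<open>frac u\<close>), normalised to vanish at the integers.\<close>

definition frac_bump :: "real \<Rightarrow> real" where
  "frac_bump u = frac u * (1 - frac u)"

lemma frac_bump_nonneg: "0 \<le> frac_bump u"
  unfolding frac_bump_def using frac_lt_1[of u] by (simp add: frac_ge_0)

lemma frac_bump_le_1: "frac_bump u \<le> 1"
  unfolding frac_bump_def using frac_lt_1[of u] by (intro mult_le_one) (simp_all add: frac_ge_0)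

lemma has_real_derivative_frac_bump:
  assumes "t \<notin> \<int>"
  shows "(frac_bump has_real_derivative (1 - 2 * frac t)) (at t)"
proof -
  define n where "n = \<lfloor>t\<rfloor>"
  have "of_int n \<noteq> t"
    using assms Ints_of_int by metis
  then have t: "t \<in> {of_int n<..<of_int n + 1}"
    using floor_correct[of t] unfolding n_def greaterThanLessThan_iff by linarith
  have "((\<lambda>u. (u - of_int n) * (1 - (u - of_int n))) has_real_derivative (1 - 2 * frac t)) (at t)"
    by (auto intro!: derivative_eq_intros simp: frac_def n_def)
  then show ?thesis
  proof (rule has_field_derivative_transform_within_open[OF _ open_greaterThanLessThan t])
    fix u :: real assume "u \<in> {of_int n<..<of_int n + 1}"
    then have "\<lfloor>u\<rfloor> = n" by (intro floor_unique) auto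
    then show "(u - of_int n) * (1 - (u - of_int n)) = frac_bump u"
      by (simp add: frac_bump_def frac_def)
  qed
qed

text \<open>At an integer \<open>t\<close> one factor is squeezed to 0 on each side:
  \<open>frac u\<close> is at most \<open>u - t\<close> on the right, \<open>1 - frac u\<close> at
  most \<open>t - u\<close> on the left, and the other factor is at most 1. This continuity lets the
  fundamental theorem of calculus pass through the jumps of \<open>frac\<close>.\<close>

lemma isCont_frac_bump: "isCont frac_bump t"
proof (cases "t \<in> \<int>")
  case False
  then show ?thesis
    by (rule DERIV_isCont[OF has_real_derivative_frac_bump])
next
  case True
  then obtain n :: int where n: "t = of_int n" by (auto elim: Ints_cases)
  have le: "norm (frac_bump u) \<le> \<bar>u - t\<bar>" for u
  proof (cases "u \<ge> t")
    case True
    then have "n \<le> \<lfloor>u\<rfloor>" by (simp add: n le_floor_iff)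
    then have "frac u \<le> u - t" by (simp add: frac_def n)
    moreover have "frac_bump u \<le> frac u"
      unfolding frac_bump_def by (intro mult_left_le) (simp_all add: frac_ge_0)
    ultimately show ?thesis using frac_bump_nonneg[of u] by simp
  next
    case False
    then have "\<lfloor>u\<rfloor> < n" by (simp add: n floor_less_iff)
    then have "real_of_int \<lfloor>u\<rfloor> \<le> of_int (n - 1)" unfolding of_int_le_iff by simp
    then have "1 - frac u \<le> t - u" by (simp add: frac_def n)
    moreover have "frac_bump u \<le> 1 - frac u"
      unfolding frac_bump_def using frac_lt_1[of u]
      by (intro mult_left_le_one_le) (simp_all add: frac_ge_0 less_imp_le)
    ultimately show ?thesis using frac_bump_nonneg[of u] by simp
  qed
  have "((\<lambda>u. \<bar>u - t\<bar>) \<longlongrightarrow> 0) (at t)"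
    by (auto intro!: tendsto_eq_intros)
  then have "(frac_bump \<longlongrightarrow> 0) (at t)"
    using le by (intro Lim_null_comparison[of frac_bump]) auto
  then show ?thesis
    by (simp add: isCont_def frac_bump_def n)
qed

section \<open>Tails of the zeta integral and their relation to \<open>psi\<close>\<close>

abbreviation zeta_integrand :: "complex \<Rightarrow> real \<Rightarrow> complex" where
  "zeta_integrand w u \<equiv> of_real u powr (- 1 - w) * complex_of_real (frac u)"

lemma zeta_integrand_integrable_tail:
  assumes "Re w > 0" "t \<ge> 1"
  shows "zeta_integrand w integrable_on {t..}"
  using set_integrable_subset[OF zeta_integrand_absolutely_integrable[OF assms(1)], of "{t..}"] assms(2)
  by (auto simp: absolutely_integrable_on_def)

lemma integral_zeta_integrand_split:
  assumes "Re w > 0" "1 \<le> s" "s \<le> t"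
  shows "integral {s..} (zeta_integrand w) =
    integral {s..t} (zeta_integrand w) + integral {t..} (zeta_integrand w)"
proof -
  have "zeta_integrand w integrable_on {s..t}"
    using powr_frac_integrable[of w t] by (rule integrable_on_subinterval) (use assms in auto)
  moreover have "zeta_integrand w integrable_on {t..}"
    using assms by (intro zeta_integrand_integrable_tail) auto
  moreover have "{s..t} \<inter> {t..} = {t}" "{s..t} \<union> {t..} = {s..}" using assms by auto
  ultimately show ?thesis
    using Henstock_Kurzweil_Integration.integral_Un[of "zeta_integrand w" "{s..t}" "{t..}"] by simp
qed

text \<open>Crude bound from \<open>frac u\<close> < 1; its decay exactly offsets the growth of
  \<open>t powr w\<close>.\<close>

lemma norm_integral_zeta_integrand_tail_le:
  assumes "Re w > 0" "t \<ge> 1"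
  shows "norm (integral {t..} (zeta_integrand w)) \<le> t powr (- Re w) / Re w"
proof -
  have "((\<lambda>u. u powr (- 1 - Re w)) has_integral (t powr (- Re w) / Re w)) {t..}"
    using has_integral_powr_to_inf[of "- 1 - Re w" t] assms by simp
  then have "norm (integral {t..} (zeta_integrand w)) \<le> integral {t..} (\<lambda>u. u powr (- 1 - Re w))"
    using assms by (intro integral_norm_bound_integral zeta_integrand_integrable_tail norm_powr_frac_le)
      (auto dest: has_integral_integrable)
  then show ?thesis
    using \<open>((\<lambda>u. u powr (- 1 - Re w)) has_integral _) _\<close> by (simp add: integral_unique)
qed

text \<open>The initial value \<open>1 / (1 - w)\<close> is the rational term of
  \<open>- (riemann_zeta w / w)\<close>, so completing the integral from \<open>{1..t}\<close> to
  \<open>{1..}\<close> produces the zeta value.\<close>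

lemma psi_eq_zeta_tail:
  assumes "w \<in> critical_strip" "t \<ge> 1"
  shows "psi w (1 / (1 - w)) t =
    - (riemann_zeta w / w) * of_real t powr w - of_real t powr w * integral {t..} (zeta_integrand w)"
proof -
  have w: "Re w > 0" "w \<noteq> 0" "1 - w \<noteq> 0"
    using assms by (auto simp: critical_strip_def)
  have "riemann_zeta w / w = - (1 / (1 - w)) - integral {1..} (zeta_integrand w)"
    unfolding riemann_zeta_def using w by (simp add: divide_simps) (simp add: algebra_simps)
  then have "1 / (1 - w) + integral {1..t} (zeta_integrand w) =
      - (riemann_zeta w / w) - integral {t..} (zeta_integrand w)"
    using integral_zeta_integrand_split[OF w(1) order_refl assms(2)] by simp
  then show ?thesis
    unfolding psi_explicit[OF assms(2)] by (simp add: right_diff_distrib)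
qed

section \<open>Asymptotics of the tail by integration by parts\<close>

text \<open>The boundary term of the integration by parts: its derivative differs from
  \<open>zeta_integrand w\<close> only by a term of order \<open>u powr (- 2 - Re w)\<close>.\<close>

definition zeta_parts :: "complex \<Rightarrow> real \<Rightarrow> complex" where
  "zeta_parts w u =
     - (of_real u powr (- 1 - w) * of_real (frac_bump u / 2)) - of_real u powr (- w) / (2 * w)"

lemma continuous_on_zeta_parts:
  assumes "w \<noteq> 0" "t > 0"
  shows "continuous_on {t..T} (zeta_parts w)"
proof -
  have "continuous_on {t..T} frac_bump"
    by (intro continuous_at_imp_continuous_on ballI isCont_frac_bump)
  then show ?thesis
    unfolding zeta_parts_def using assms by (intro continuous_intros) auto
qed

text \<open>Differentiating \<open>frac_bump\<close> yields the factor \<open>frac u - 1/2\<close>,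
  and the term \<open>- of_real u powr (- w) / (2 * w)\<close> restores the missing 1/2.\<close>

lemma has_vector_derivative_zeta_parts:
  assumes "w \<noteq> 0" "u > 0" "u \<notin> \<int>"
  shows "(zeta_parts w has_vector_derivative
    (zeta_integrand w u + (1 + w) * of_real u powr (- 2 - w) * of_real (frac_bump u / 2))) (at u)"
proof -
  have "((\<lambda>u. frac_bump u / 2) has_real_derivative (1 - 2 * frac u) / 2) (at u)"
    by (intro DERIV_cdivide has_real_derivative_frac_bump assms)
  then have "((\<lambda>u. complex_of_real (frac_bump u / 2)) has_vector_derivative
      complex_of_real ((1 - 2 * frac u) / 2)) (at u)"
    by (rule has_vector_derivative_of_real)
  then have "(zeta_parts w has_vector_derivative
     (- (of_real u powr (- 1 - w) * complex_of_real ((1 - 2 * frac u) / 2)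
          + (- 1 - w) * of_real u powr (- 1 - w - 1) * complex_of_real (frac_bump u / 2))
      - (- w) * of_real u powr (- w - 1) / (2 * w))) (at u)"
    unfolding zeta_parts_def using assms
    by (intro has_vector_derivative_diff has_vector_derivative_minus has_vector_derivative_mult
        has_vector_derivative_divide powr_has_vector_derivative)
  moreover have exps: "- 1 - w - 1 = - 2 - w" "- w - 1 = - 1 - w" by simp_all
  ultimately show ?thesis
    using assms by (elim has_vector_derivative_eq_rhs) (simp only: exps, simp add: field_simps)
qed

text \<open>The difference is minus the integral of the extra term in the derivative of
  \<open>zeta_parts\<close>. Bounding that integral over all of \<open>{t..}\<close> keeps the
  estimate independent of \<open>T\<close>, ready for a limit.\<close>

lemma norm_integral_zeta_integrand_minus_parts_le:
  assumes w: "Re w > 0" and t: "1 \<le> t" "t \<le> T"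
  shows "norm (integral {t..T} (zeta_integrand w) - (zeta_parts w T - zeta_parts w t))
    \<le> norm (1 + w) * t powr (- 1 - Re w)"
proof -
  have w0: "w \<noteq> 0" using w by auto
  define g where "g u = (1 + w) * of_real u powr (- 2 - w) * of_real (frac_bump u / 2)" for u :: real
  \<comment> \<open>The derivative formula fails at most at these integers, where continuity
    suffices.\<close>
  have fin: "finite {u \<in> \<int>. t \<le> u \<and> u \<le> T}"
    by (rule finite_int_segment)
  have "((\<lambda>u. zeta_integrand w u + g u) has_integral (zeta_parts w T - zeta_parts w t)) {t..T}"
    unfolding g_def using t w0
    by (intro fundamental_theorem_of_calculus_interior_strong[OF fin] continuous_on_zeta_parts
        has_vector_derivative_zeta_parts) auto
  moreover have "zeta_integrand w integrable_on {t..T}"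
    using powr_frac_integrable[of w T] by (rule integrable_on_subinterval) (use t in auto)
  ultimately have "((\<lambda>u. zeta_integrand w u - (zeta_integrand w u + g u)) has_integral
      (integral {t..T} (zeta_integrand w) - (zeta_parts w T - zeta_parts w t))) {t..T}"
    by (intro has_integral_diff) auto
  then have g: "((\<lambda>u. - g u) has_integral
      (integral {t..T} (zeta_integrand w) - (zeta_parts w T - zeta_parts w t))) {t..T}"
    by simp
  have "((\<lambda>u. u powr (- 2 - Re w)) has_integral (t powr (- 1 - Re w) / (1 + Re w))) {t..}"
    using has_integral_powr_to_inf[of "- 2 - Re w" t] w t
      minus_divide_divide[of "t powr (- 1 - Re w)" "1 + Re w"] by simp
  note P = has_integral_mult_right[OF this, of "norm (1 + w)"]
  have Pi: "(\<lambda>u. norm (1 + w) * u powr (- 2 - Re w)) integrable_on {t..T}"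
    using t by (intro integrable_continuous_interval continuous_intros) auto
  have "norm (integral {t..T} (\<lambda>u. - g u)) \<le> integral {t..T} (\<lambda>u. norm (1 + w) * u powr (- 2 - Re w))"
  proof (rule integral_norm_bound_integral[OF has_integral_integrable[OF g] Pi])
    fix u assume u: "u \<in> {t..T}"
    have p: "norm (complex_of_real u powr (- 2 - w)) = u powr (- 2 - Re w)"
      using u t by (subst norm_powr_real_powr) auto
    have q: "norm (complex_of_real (frac_bump u / 2)) \<le> 1"
      unfolding norm_of_real using frac_bump_nonneg[of u] frac_bump_le_1[of u] by simp
    show "norm (- g u) \<le> norm (1 + w) * u powr (- 2 - Re w)"
      unfolding g_def norm_minus_cancel norm_mult p by (intro mult_left_le[OF q]) auto
  qed
  also have "\<dots> \<le> integral {t..} (\<lambda>u. norm (1 + w) * u powr (- 2 - Re w))"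
    using Pi has_integral_integrable[OF P] by (intro integral_subset_le) auto
  also have "\<dots> = norm (1 + w) * (t powr (- 1 - Re w) / (1 + Re w))"
    using P by (rule integral_unique)
  \<comment> \<open>The factor 1 / (1 + Re w) is below 1 and is dropped.\<close>
  also have "\<dots> \<le> norm (1 + w) * t powr (- 1 - Re w)"
    using w by (intro mult_left_mono) (auto simp: divide_le_eq mult_le_cancel_left1)
  finally show ?thesis
    unfolding integral_unique[OF g] .
qed

text \<open>Letting \<open>T\<close> tend to infinity in the previous estimate compares the tail
  with \<open>- zeta_parts w t\<close>. That is the main term plus a \<open>frac_bump\<close> term,
  whose size accounts for the \<open>+ 1\<close> in the constant.\<close>

lemma norm_zeta_tail_minus_main_le:
  assumes w: "Re w > 0" and t: "1 \<le> t"
  shows "norm (integral {t..} (zeta_integrand w) - of_real t powr (- w) / (2 * w))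
    \<le> (norm (1 + w) + 1) * t powr (- 1 - Re w)"
proof -
  have w0: "w \<noteq> 0" using w by auto
  let ?R = "\<lambda>t. integral {t..} (zeta_integrand w)"
  have norm_powr: "norm (complex_of_real u powr z) = u powr Re z" if "u \<ge> 1" for u z
    using that by (subst norm_powr_real_powr) auto
  have bump: "norm (complex_of_real u powr (- 1 - w) * of_real (frac_bump u / 2)) \<le> u powr (- 1 - Re w)"
    if "u \<ge> 1" for u
    unfolding norm_mult norm_powr[OF that] norm_of_real
    using frac_bump_nonneg[of u] frac_bump_le_1[of u]
    by (simp only: minus_complex.sel uminus_complex.sel one_complex.sel) (intro mult_left_le; simp)
  have lim: "((\<lambda>u. u powr a) \<longlongrightarrow> 0) at_top" if "a < 0" for a :: real
    using that by (intro tendsto_neg_powr filterlim_ident)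
  have E1: "((\<lambda>T. of_real T powr (- 1 - w) * of_real (frac_bump T / 2)) \<longlongrightarrow> (0::complex)) at_top"
    by (rule Lim_null_comparison[OF eventually_mono[OF eventually_ge_at_top bump] lim]) (use w in auto)
  have E2: "((\<lambda>T. of_real T powr (- w)) \<longlongrightarrow> (0::complex)) at_top"
    by (rule Lim_null_comparison[OF eventually_mono[OF eventually_ge_at_top[of 1]] lim[of "- Re w"]])
      (use w in \<open>auto simp: norm_powr\<close>)
  have E: "(zeta_parts w \<longlongrightarrow> 0) at_top"
    unfolding zeta_parts_def
    using tendsto_diff[OF tendsto_minus[OF E1] tendsto_divide[OF E2 tendsto_const[of "2 * w"]]] w0 by simp
  have R: "(?R \<longlongrightarrow> 0) at_top"
  proof (rule Lim_null_comparison)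
    show "\<forall>\<^sub>F T in at_top. norm (?R T) \<le> T powr (- Re w) / Re w"
      using eventually_ge_at_top[of 1]
      by eventually_elim (rule norm_integral_zeta_integrand_tail_le[OF w])
    show "((\<lambda>T. T powr (- Re w) / Re w) \<longlongrightarrow> 0) at_top"
      using tendsto_divide[OF lim[of "- Re w"] tendsto_const[of "Re w"]] w by simp
  qed
  \<comment> \<open>With the integral over \<open>{t..T}\<close> written as
    \<open>?R t - ?R T\<close>, everything depending on \<open>T\<close> vanishes in the limit, and
    the bound persists.\<close>
  have "norm (?R t + zeta_parts w t) \<le> norm (1 + w) * t powr (- 1 - Re w)"
  proof (rule tendsto_upperbound)
    show "((\<lambda>T. norm (?R t - ?R T - (zeta_parts w T - zeta_parts w t))) \<longlongrightarrow>
        norm (?R t + zeta_parts w t)) at_top"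
      using E R by (auto intro!: tendsto_eq_intros)
    show "\<forall>\<^sub>F T in at_top. norm (?R t - ?R T - (zeta_parts w T - zeta_parts w t))
        \<le> norm (1 + w) * t powr (- 1 - Re w)"
      using eventually_ge_at_top[of t]
    proof eventually_elim
      case (elim T)
      then show ?case
        using norm_integral_zeta_integrand_minus_parts_le[OF w t elim]
          integral_zeta_integrand_split[OF w t elim] by simp
    qed
  qed simp
  moreover have "?R t - of_real t powr (- w) / (2 * w) =
      (?R t + zeta_parts w t) + of_real t powr (- 1 - w) * of_real (frac_bump t / 2)"
    by (simp add: zeta_parts_def)
  ultimately show ?thesis
    using norm_triangle_mono[OF _ bump[OF t]] by (simp only: distrib_right mult_1)
qed

section \<open>Boundedness criteria\<close>

text \<open>Suprema are taken in \<open>ereal\<close> so that an unbounded family really has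
  supremum infinity; a real \<open>Sup\<close> would be an arbitrary number there.\<close>

lemma SUP_ereal_norm_less_infinity_iff:
  fixes g :: "'a \<Rightarrow> 'b::real_normed_vector"
  assumes "A \<noteq> {}"
  shows "(SUP t\<in>A. ereal (norm (g t))) < \<infinity> \<longleftrightarrow> (\<exists>B. \<forall>t\<in>A. norm (g t) \<le> B)"
proof
  assume *: "(SUP t\<in>A. ereal (norm (g t))) < \<infinity>"
  have le: "ereal (norm (g t)) \<le> (SUP t\<in>A. ereal (norm (g t)))" if "t \<in> A" for t
    using that by (rule SUP_upper)
  then show "\<exists>B. \<forall>t\<in>A. norm (g t) \<le> B"
    using * assms by (cases "SUP t\<in>A. ereal (norm (g t))") auto
next
  assume "\<exists>B. \<forall>t\<in>A. norm (g t) \<le> B"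
  then obtain B where "\<forall>t\<in>A. norm (g t) \<le> B" by blast
  then have "(SUP t\<in>A. ereal (norm (g t))) \<le> ereal B" by (intro SUP_least) auto
  also have "\<dots> < \<infinity>" by simp
  finally show "(SUP t\<in>A. ereal (norm (g t))) < \<infinity>" .
qed

lemma norm_powr_mult_tail_le:
  assumes "Re w > 0" "t \<ge> 1"
  shows "norm (of_real t powr w * integral {t..} (zeta_integrand w)) \<le> 1 / Re w"
proof -
  have "norm (of_real t powr w * integral {t..} (zeta_integrand w))
      \<le> t powr Re w * (t powr (- Re w) / Re w)"
    using norm_integral_zeta_integrand_tail_le[OF assms] assms
    unfolding norm_mult by (intro mult_mono) (auto simp: norm_powr_real_powr)
  also have "\<dots> = 1 / Re w"
    using assms by (simp add: powr_minus)
  finally show ?thesis .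
qed

text \<open>Were the zeta value nonzero, solving the decomposition of \<open>psi\<close> for
  \<open>t powr w\<close> would bound \<open>t powr Re w\<close>, which is unbounded because Re w >
  0.\<close>

lemma psi_bounded_imp_zeta_zero:
  assumes w: "w \<in> critical_strip" and B: "\<And>t. t \<ge> 1 \<Longrightarrow> norm (psi w (1 / (1 - w)) t) \<le> B"
  shows "riemann_zeta w = 0"
proof (rule ccontr)
  assume "riemann_zeta w \<noteq> 0"
  moreover have w': "Re w > 0" "w \<noteq> 0"
    using w by (auto simp: critical_strip_def)
  ultimately have c: "norm (riemann_zeta w / w) > 0" by simp
  have le: "t powr Re w \<le> (B + 1 / Re w) / norm (riemann_zeta w / w)" if t: "t \<ge> 1" for t
  proof -
    have "- (riemann_zeta w / w) * of_real t powr w =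
        psi w (1 / (1 - w)) t + of_real t powr w * integral {t..} (zeta_integrand w)"
      by (simp add: psi_eq_zeta_tail[OF w t])
    then have "norm (- (riemann_zeta w / w) * of_real t powr w) \<le> B + 1 / Re w"
      using norm_triangle_mono[OF B[OF t] norm_powr_mult_tail_le[OF w'(1) t]] by simp
    moreover have "norm (- (riemann_zeta w / w) * of_real t powr w) = norm (riemann_zeta w / w) * t powr Re w"
      unfolding norm_mult norm_minus_cancel using t by (simp add: norm_powr_real_powr)
    ultimately show ?thesis
      using c by (metis pos_le_divide_eq mult.commute)
  qed
  define K where "K = (B + 1 / Re w) / norm (riemann_zeta w / w)"
  \<comment> \<open>Chosen so that \<open>t powr Re w\<close> exceeds \<open>K\<close>; the absolute
    value and the added 1 also ensure \<open>t\<close> is at least 1.\<close>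
  define t where "t = (\<bar>K\<bar> + 1) powr (1 / Re w)"
  have "t \<ge> 1"
    unfolding t_def using w' by (intro ge_one_powr_ge_zero) auto
  moreover have "t powr Re w = \<bar>K\<bar> + 1"
    unfolding t_def using w' by (simp add: powr_powr)
  ultimately show False
    using le[of t] by (simp add: K_def[symmetric])
qed

text \<open>Only the tail term of \<open>psi\<close> is left, and adding \<open>1 / (2 * w)\<close>
  removes its main term. The prefactors \<open>t\<close> and \<open>t powr Re w\<close> then cancel
  the error rate \<open>t powr (- 1 - Re w)\<close>.\<close>

lemma zeta_zero_imp_psi_asymp:
  assumes w: "w \<in> critical_strip" and zeta: "riemann_zeta w = 0" and t: "t \<ge> 1"
  shows "norm (of_real t * (psi w (1 / (1 - w)) t + 1 / (2 * w))) \<le> norm (1 + w) + 1"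
proof -
  have w': "Re w > 0" "w \<noteq> 0"
    using w by (auto simp: critical_strip_def)
  have "complex_of_real t powr w * of_real t powr (- w) = 1"
    using t by (simp add: powr_minus)
  then have "psi w (1 / (1 - w)) t + 1 / (2 * w) =
      - (of_real t powr w * (integral {t..} (zeta_integrand w) - of_real t powr (- w) / (2 * w)))"
    by (simp add: psi_eq_zeta_tail[OF w t] zeta right_diff_distrib)
  then have "norm (of_real t * (psi w (1 / (1 - w)) t + 1 / (2 * w))) =
      t * (t powr Re w * norm (integral {t..} (zeta_integrand w) - of_real t powr (- w) / (2 * w)))"
    using t by (simp only: norm_mult norm_minus_cancel) (simp add: norm_powr_real_powr)
  also have "\<dots> \<le> t * (t powr Re w * ((norm (1 + w) + 1) * t powr (- 1 - Re w)))"
    using t by (intro mult_left_mono norm_zeta_tail_minus_main_le w') auto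
  also have "\<dots> = norm (1 + w) + 1"
    using t by (simp add: powr_diff powr_minus)
  finally show ?thesis .
qed

theorem theorem3p1:
  shows "(\<forall>w\<in>critical_strip. riemann_zeta w = 0 \<longleftrightarrow>
            (SUP t\<in>{1..}. ereal (norm (psi w (1 / (1 - w)) t))) < \<infinity>) \<and>
         (\<forall>w\<in>critical_strip. riemann_zeta w = 0 \<longleftrightarrow>
            (SUP t\<in>{1..}. ereal (norm (of_real t * (psi w (1 / (1 - w)) t + 1 / (2 * w))))) < \<infinity>)"
proof (intro conjI ballI)
  fix w assume w: "w \<in> critical_strip"
  then have "Re w > 0" by (simp add: critical_strip_def)
  then have "\<forall>t\<in>{1..}. norm (psi w (1 / (1 - w)) t) \<le> 1 / Re w" if "riemann_zeta w = 0"
    using norm_powr_mult_tail_le psi_eq_zeta_tail[OF w] that by simp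
  then show "riemann_zeta w = 0 \<longleftrightarrow> (SUP t\<in>{1..}. ereal (norm (psi w (1 / (1 - w)) t))) < \<infinity>"
    using psi_bounded_imp_zeta_zero[OF w] by (subst SUP_ereal_norm_less_infinity_iff) auto
next
  fix w assume w: "w \<in> critical_strip"
  \<comment> \<open>Since \<open>t\<close> is at least 1, the weighted bound also bounds
    \<open>psi\<close> up to the constant \<open>1 / (2 * w)\<close>, which reduces this direction
    to the first criterion.\<close>
  have "riemann_zeta w = 0"
    if B: "\<forall>t\<in>{1..}. norm (of_real t * (psi w (1 / (1 - w)) t + 1 / (2 * w))) \<le> B" for B
  proof (rule psi_bounded_imp_zeta_zero[OF w])
    fix t :: real assume t: "t \<ge> 1"
    let ?d = "psi w (1 / (1 - w)) t + 1 / (2 * w)"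
    have "norm ?d \<le> t * norm ?d"
      using t by (simp add: mult_le_cancel_right1)
    also have "\<dots> \<le> B"
      using bspec[OF B, of t] t by (simp add: norm_mult)
    finally show "norm (psi w (1 / (1 - w)) t) \<le> B + norm (1 / (2 * w))"
      using norm_triangle_ineq4[of ?d "1 / (2 * w)"] by simp
  qed
  then show "riemann_zeta w = 0 \<longleftrightarrow>
      (SUP t\<in>{1..}. ereal (norm (of_real t * (psi w (1 / (1 - w)) t + 1 / (2 * w))))) < \<infinity>"
    using zeta_zero_imp_psi_asymp[OF w] by (subst SUP_ereal_norm_less_infinity_iff) auto
qed

end
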